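(* For all $\alpha>0$, $k^t\in\mathbb{N}$, $k^d\in\mathbb{N}$, the competitive ratio of the policy Regretless satisfies $$\sigma(\mathrm{Regretless})\ \le\ 1+\left\lceil\frac{k^d}{k^t}\right\rceil\alpha.$$
   Context: Relief distribution problem (RDP). $\mathbb{N}=\{1,2,\dots\}$. An instance is $I=(k^t,k^d,\alpha,G,D)$: $k^t,k^d\in\mathbb{N}$ are the numbers of trucks and drones; $\alpha>0$ is the drone speed; $G=(V,E,c)$ is a finite connected undirected graph (not necessarily complete) with $V=\{v_0\}\cup C$, where $v_0$ is the depot and $C\neq\emptyset$ is the set of non-depot nodes; edge lengths $c(i,j)>0$ satisfy the triangle inequality; $D\subseteq C$ is the set of damaged nodes, initially unknown; the status of a node is revealed (instantly to all) when some vehicle first arrives at it. For non-adjacent $i,j$, $c(i,j)$ is the shortest-path distance. A truck needs time $c(i,j)$ to traverse an edge, a drone needs $\frac1\alpha c(i,j)$. A tour is a closed walk in $G$ starting and ending at $v_0$ (possibly of length $0$); it may be written as a sequence of nodes, consecutive nodes being joined by shortest paths, and $c(t)$ is the length of tour $t$. The makespan of a family of tours is the maximum duration of a tour. Full-information optimum: $\mathrm{OPT}(I^* )$ is the minimum makespan over all families of $k^t$ truck tours and $k^d$ drone tours such that every node of $C$ is visited by some vehicle and every node of $D$ is visited by a truck ($I^*$ is the instance $I$ with $D$ known in advance). For integers $m,n\ge 0$ with $m+n\ge1$ and $W\subseteq C$, $S^*_{m,n}(W)$ denotes a family of $m$ truck tours and $n$ drone tours together visiting all nodes of $W$ with minimum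 makespan. Policy Regretless (deterministic; choices among optimal solutions are made by a fixed rule using only the information available at that time). First stage: compute $S^*_{k^t,0}(C)=\{s^*_1,\dots,s^*_{k^t}\}$, written as $s^*_i=(v_0,v_{(1)},\dots,v_{(n_i)},v_0)$ so that each node of $C$ is listed exactly once in exactly one tour. Assign one truck to each tour and distribute the drones as evenly as possible, so each tour receives $\lceil k^d/k^t\rceil$ or $\lfloor k^d/k^t\rfloor$ drones; let $k_i$ be the number of vehicles assigned to $s_i^*$. Split $(v_{(1)},\dots,v_{(n_i)})$ into up to $k_i$ consecutive nonempty segments $\Delta_i^l=(v_{(j_l)},\dots,v_{(j_{l+1}-1)})$, $j_1=1$; the truck is assigned the tour $t_i^1=(v_0,v_{(1)},\dots,v_{(j_2-1)},v_0)$ and each further segment $l\ge2$ is assigned to one drone, with the reversed tour $t_i^l=(v_0,v_{(j_{l+1}-1)},\dots,v_{(j_l)},v_0)$; the splitting is chosen to minimize $\max\{c(t_i^1),\max_{l\ge2} c(t_i^l)/\alpha\}$. All vehicles start at time $0$. Second stage (replanning), for each $i$: when truck $i$ reaches the last node $v_{(j_2-1)}$ of its segment, let $D_i^d$ be the set of damaged nodes of $s_i^*$ not yet visited by the truck and $C_i^d$ the set of nodes of $s_i^*$ not yet visited by any vehicle; the truck then follows a minimum-length walk from its current node visiting all of $D_i^d\cup C_i^d$ and ending at $v_0$. The drones complete their tours. $\mathrm{Regretless}(I)$ is the time at which the last vehicle has returned to $v_0$. Competitive ratio: $\sigma(\mathrm{Regretless})=\sup_I \frac{\mathrm{Regretless}(I)}{\mathrm{OPT}(I^*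 )}$, the supremum being over all instances $I$ with the given $k^t,k^d,\alpha$. *)

theory Defs
  imports "Graph_Theory.Graph_Theory"
begin

section \<open>Instances of the relief distribution problem\<close>

text \<open>
  An instance is a pair of a record, holding everything that is known in advance, and the set of
  damaged nodes, which is initially unknown. Undirected simple graphs are the symmetric loop-free
  digraphs of \<^locale>\<open>pair_graph\<close>; each edge is present as two opposite arcs.
\<close>

record 'v rdp =
  trucks :: nat
  drones :: nat
  speed :: real
  network :: "'v pair_pre_digraph"
  edge_len :: "'v \<times> 'v \<Rightarrow> real"
  depot :: 'v

definition customers :: "'v rdp \<Rightarrow> 'v set" where
  "customers K = pverts (network K) - {depot K}"

text \<open>
  The triangle inequality is required for the triangles of the graph only. Tours are joined by
  shortest paths, so no extension of the edge lengths to all pairs of nodes is needed here, and the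
  instances in which every edge is a shortest path between its ends are included.
\<close>

definition rdp_instance :: "'v rdp \<Rightarrow> 'v set \<Rightarrow> bool" where
  "rdp_instance K D \<longleftrightarrow>
     1 \<le> trucks K \<and> 1 \<le> drones K \<and> 0 < speed K \<and>
     pair_graph (network K) \<and> Digraph_Component.connected (with_proj (network K)) \<and>
     depot K \<in> pverts (network K) \<and> customers K \<noteq> {} \<and>
     (\<forall>u v. (u, v) \<in> parcs (network K) \<longrightarrow>
        0 < edge_len K (u, v) \<and> edge_len K (u, v) = edge_len K (v, u)) \<and>
     (\<forall>u v w. (u, v) \<in> parcs (network K) \<and> (u, w) \<in> parcs (network K) \<and>
        (w, v) \<in> parcs (network K) \<longrightarrow>
        edge_len K (u, v) \<le> edge_len K (u, w) + edge_len K (w, v)) \<and>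
     D \<subseteq> customers K"

section \<open>Walks and tours\<close>

abbreviation walk :: "'v rdp \<Rightarrow> 'v \<Rightarrow> ('v \<times> 'v) awalk \<Rightarrow> 'v \<Rightarrow> bool" where
  "walk K \<equiv> pre_digraph.awalk (with_proj (network K))"

abbreviation walk_verts :: "'v rdp \<Rightarrow> 'v \<Rightarrow> ('v \<times> 'v) awalk \<Rightarrow> 'v list" where
  "walk_verts K \<equiv> pre_digraph.awalk_verts (with_proj (network K))"

abbreviation walk_len :: "'v rdp \<Rightarrow> ('v \<times> 'v) awalk \<Rightarrow> real" where
  "walk_len K \<equiv> wf_digraph.awalk_cost (edge_len K)"

abbreviation sp_dist :: "'v rdp \<Rightarrow> 'v \<Rightarrow> 'v \<Rightarrow> real" where
  "sp_dist K u v \<equiv> real_of_ereal (wf_digraph.\<mu> (with_proj (network K)) (edge_len K) u v)"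

definition tour :: "'v rdp \<Rightarrow> ('v \<times> 'v) awalk \<Rightarrow> bool" where
  "tour K p \<longleftrightarrow> walk K (depot K) p (depot K)"

definition tour_nodes :: "'v rdp \<Rightarrow> ('v \<times> 'v) awalk \<Rightarrow> 'v set" where
  "tour_nodes K p = set (walk_verts K (depot K) p)"

text \<open>\<open>joins K vs p\<close>: the walk \<open>p\<close> runs through the nodes \<open>vs\<close> in this order, consecutive nodes being
  joined by shortest paths.\<close>

fun joins :: "'v rdp \<Rightarrow> 'v list \<Rightarrow> ('v \<times> 'v) awalk \<Rightarrow> bool" where
  "joins K [] p \<longleftrightarrow> False"
| "joins K [u] p \<longleftrightarrow> p = []"
| "joins K (u # v # vs) p \<longleftrightarrow>
     (\<exists>q r. p = q @ r \<and> walk K u q v \<and> walk_len K q = sp_dist K u v \<and> joins K (v # vs) r)"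

fun seq_len :: "'v rdp \<Rightarrow> 'v list \<Rightarrow> real" where
  "seq_len K (u # v # vs) = sp_dist K u v + seq_len K (v # vs)"
| "seq_len K vs = 0"

definition closed_seq :: "'v rdp \<Rightarrow> 'v list \<Rightarrow> 'v list" where
  "closed_seq K vs = depot K # vs @ [depot K]"

section \<open>Optimal families of tours\<close>

text \<open>Below, \<open>T\<close> always lists truck tours and \<open>U\<close> drone tours.\<close>

definition makespan ::
    "'v rdp \<Rightarrow> ('v \<times> 'v) awalk list \<Rightarrow> ('v \<times> 'v) awalk list \<Rightarrow> real" where
  "makespan K T U = Max (walk_len K ` set T \<union> (\<lambda>p. walk_len K p / speed K) ` set U)"

definition family :: "'v rdp \<Rightarrow> nat \<Rightarrow> nat \<Rightarrow> 'v set \<Rightarrow>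
    ('v \<times> 'v) awalk list \<Rightarrow> ('v \<times> 'v) awalk list \<Rightarrow> bool" where
  "family K m n W T U \<longleftrightarrow>
     length T = m \<and> length U = n \<and> (\<forall>p \<in> set T \<union> set U. tour K p) \<and>
     W \<subseteq> (\<Union>p \<in> set T \<union> set U. tour_nodes K p)"

definition optimal_family :: "'v rdp \<Rightarrow> nat \<Rightarrow> nat \<Rightarrow> 'v set \<Rightarrow>
    ('v \<times> 'v) awalk list \<Rightarrow> ('v \<times> 'v) awalk list \<Rightarrow> bool" where
  "optimal_family K m n W T U \<longleftrightarrow>
     family K m n W T U \<and>
     (\<forall>T' U'. family K m n W T' U' \<longrightarrow> makespan K T U \<le> makespan K T' U')"

text \<open>
  There are only finitely many walks below any given length, so the infimum is a minimum; it is
  positive, as some node other than the depot has to be visited.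
\<close>

definition full_info_opt :: "'v rdp \<Rightarrow> 'v set \<Rightarrow> real" where
  "full_info_opt K D =
     Inf {makespan K T U | T U.
            family K (trucks K) (drones K) (customers K) T U \<and>
            D \<subseteq> (\<Union>p \<in> set T. tour_nodes K p)}"

section \<open>The policy Regretless\<close>

subsection \<open>First stage\<close>

text \<open>
  All lists are indexed by the trucks. The tours \<open>base_tours\<close> form an optimal family for the trucks
  alone, written without the depot; tour \<open>i\<close> is given to truck \<open>i\<close> and \<open>crew ! i\<close> drones. The walk
  \<open>truck_out ! i\<close> ends at the last node of the segment of truck \<open>i\<close>, since the truck never follows the
  way back of its initially assigned tour. Drones without a segment stay at the depot and do not
  occur in \<open>drone_tours\<close>.
\<close>

record 'v plan =
  base_tours :: "'v list list"
  crew :: "nat list"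
  segments :: "'v list list list"
  truck_out :: "('v \<times> 'v) awalk list"
  drone_tours :: "('v \<times> 'v) awalk list list"

definition base_tours_ok :: "'v rdp \<Rightarrow> 'v list list \<Rightarrow> bool" where
  "base_tours_ok K ss \<longleftrightarrow>
     distinct (concat ss) \<and> set (concat ss) = customers K \<and>
     (\<exists>T. list_all2 (\<lambda>s p. joins K (closed_seq K s) p) ss T \<and>
          optimal_family K (trucks K) 0 (customers K) T [])"

definition crew_ok :: "'v rdp \<Rightarrow> nat list \<Rightarrow> bool" where
  "crew_ok K ks \<longleftrightarrow>
     length ks = trucks K \<and> sum_list ks = drones K \<and>
     (\<forall>k \<in> set ks. int k = \<lceil>real (drones K) / real (trucks K)\<rceil> \<or>
                  int k = \<lfloor>real (drones K) / real (trucks K)\<rfloor>)"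

definition splitting :: "'v list \<Rightarrow> nat \<Rightarrow> 'v list list \<Rightarrow> bool" where
  "splitting s k ds \<longleftrightarrow> concat ds = s \<and> [] \<notin> set ds \<and> length ds \<le> k"

fun splitting_cost :: "'v rdp \<Rightarrow> 'v list list \<Rightarrow> real" where
  "splitting_cost K [] = 0"
| "splitting_cost K (d # ds) =
     Max (insert (seq_len K (closed_seq K d))
           ((\<lambda>e. seq_len K (closed_seq K (rev e)) / speed K) ` set ds))"

definition optimal_splitting :: "'v rdp \<Rightarrow> 'v list \<Rightarrow> nat \<Rightarrow> 'v list list \<Rightarrow> bool" where
  "optimal_splitting K s k ds \<longleftrightarrow>
     splitting s k ds \<and>
     (\<forall>ds'. splitting s k ds' \<longrightarrow> splitting_cost K ds \<le> splitting_cost K ds')"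

definition truck_segment :: "'v list list \<Rightarrow> 'v list" where
  "truck_segment ds = (case ds of [] \<Rightarrow> [] | d # _ \<Rightarrow> d)"

definition first_stage_ok :: "'v rdp \<Rightarrow> 'v plan \<Rightarrow> bool" where
  "first_stage_ok K \<pi> \<longleftrightarrow>
     base_tours_ok K (base_tours \<pi>) \<and> crew_ok K (crew \<pi>) \<and>
     length (segments \<pi>) = trucks K \<and> length (truck_out \<pi>) = trucks K \<and>
     length (drone_tours \<pi>) = trucks K \<and>
     (\<forall>i < trucks K.
        optimal_splitting K (base_tours \<pi> ! i) (1 + crew \<pi> ! i) (segments \<pi> ! i) \<and>
        joins K (depot K # truck_segment (segments \<pi> ! i)) (truck_out \<pi> ! i) \<and>
        list_all2 (\<lambda>d p. joins K (closed_seq K (rev d)) p)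
          (tl (segments \<pi> ! i)) (drone_tours \<pi> ! i))"

subsection \<open>Second stage\<close>

text \<open>
  A policy maps the data known in advance to a plan; its second component gives, for every set of
  damaged nodes and every truck, the walk followed after replanning.
\<close>

record 'v policy =
  stage1 :: "'v rdp \<Rightarrow> 'v plan"
  stage2 :: "'v rdp \<Rightarrow> 'v set \<Rightarrow> nat \<Rightarrow> ('v \<times> 'v) awalk"

definition truck_route :: "'v policy \<Rightarrow> 'v rdp \<Rightarrow> 'v set \<Rightarrow> nat \<Rightarrow> ('v \<times> 'v) awalk" where
  "truck_route P K D i = truck_out (stage1 P K) ! i @ stage2 P K D i"

text \<open>The nodes at which a vehicle of speed \<open>a\<close>, leaving the depot at time 0 along \<open>p\<close>, has arrived
  by time \<open>t\<close>.\<close>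

definition reached :: "'v rdp \<Rightarrow> real \<Rightarrow> ('v \<times> 'v) awalk \<Rightarrow> real \<Rightarrow> 'v set" where
  "reached K a p t =
     {walk_verts K (depot K) p ! j | j. j \<le> length p \<and> walk_len K (take j p) / a \<le> t}"

definition visited :: "'v policy \<Rightarrow> 'v rdp \<Rightarrow> 'v set \<Rightarrow> real \<Rightarrow> 'v set" where
  "visited P K D t =
     (\<Union>i < trucks K. reached K 1 (truck_route P K D i) t) \<union>
     (\<Union>i < trucks K. \<Union>p \<in> set (drone_tours (stage1 P K) ! i). reached K (speed K) p t)"

definition replan_time :: "'v policy \<Rightarrow> 'v rdp \<Rightarrow> nat \<Rightarrow> real" where
  "replan_time P K i = walk_len K (truck_out (stage1 P K) ! i)"

definition replan_node :: "'v policy \<Rightarrow> 'v rdp \<Rightarrow> nat \<Rightarrow> 'v" where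
  "replan_node P K i = last (depot K # truck_segment (segments (stage1 P K) ! i))"

definition damaged_left :: "'v policy \<Rightarrow> 'v rdp \<Rightarrow> 'v set \<Rightarrow> nat \<Rightarrow> 'v set" where
  "damaged_left P K D i =
     D \<inter> set (base_tours (stage1 P K) ! i) -
     reached K 1 (truck_route P K D i) (replan_time P K i)"

definition unvisited_left :: "'v policy \<Rightarrow> 'v rdp \<Rightarrow> 'v set \<Rightarrow> nat \<Rightarrow> 'v set" where
  "unvisited_left P K D i =
     set (base_tours (stage1 P K) ! i) - visited P K D (replan_time P K i)"

definition optimal_covering_walk ::
    "'v rdp \<Rightarrow> 'v \<Rightarrow> 'v set \<Rightarrow> ('v \<times> 'v) awalk \<Rightarrow> bool" where
  "optimal_covering_walk K u W p \<longleftrightarrow>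
     walk K u p (depot K) \<and> W \<subseteq> set (walk_verts K u p) \<and>
     (\<forall>q. walk K u q (depot K) \<and> W \<subseteq> set (walk_verts K u q) \<longrightarrow> walk_len K p \<le> walk_len K q)"

text \<open>
  All arcs have positive length, so what has been visited by the replanning time of a truck does not
  depend on the walks chosen at or after that time; the second conjunct below is therefore not
  circular. The last conjunct says that a choice is made from the information available at the time:
  if two instances agree on all nodes whose status has been revealed by the replanning time of
  truck \<open>i\<close>, then truck \<open>i\<close> continues in the same way in both.
\<close>

definition regretless_policy :: "'v policy \<Rightarrow> bool" where
  "regretless_policy P \<longleftrightarrow>
     (\<forall>K D. rdp_instance K D \<longrightarrow> first_stage_ok K (stage1 P K)) \<and>
     (\<forall>K D i. rdp_instance K D \<and> i < trucks K \<longrightarrow>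
        optimal_covering_walk K (replan_node P K i)
          (damaged_left P K D i \<union> unvisited_left P K D i) (stage2 P K D i)) \<and>
     (\<forall>K D D' i. rdp_instance K D \<and> rdp_instance K D' \<and> i < trucks K \<and>
        D \<inter> visited P K D (replan_time P K i) = D' \<inter> visited P K D (replan_time P K i) \<longrightarrow>
        stage2 P K D i = stage2 P K D' i)"

definition completion_time :: "'v policy \<Rightarrow> 'v rdp \<Rightarrow> 'v set \<Rightarrow> real" where
  "completion_time P K D =
     makespan K (map (truck_route P K D) [0..<trucks K]) (concat (drone_tours (stage1 P K)))"

section \<open>Competitive ratio\<close>

definition competitive_ratio :: "'v policy \<Rightarrow> nat \<Rightarrow> nat \<Rightarrow> real \<Rightarrow> ereal" where
  "competitive_ratio P kt kd \<alpha> =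
     (SUP (K, D) \<in> {(K, D). rdp_instance K D \<and> trucks K = kt \<and> drones K = kd \<and> speed K = \<alpha>}.
        ereal (completion_time P K D) / ereal (full_info_opt K D))"

end

theory Submission
  imports Defs
begin

text \<open>Let \<open>X\<close> be the makespan of the optimal tours for the trucks alone. Truck \<open>i\<close> could serve all its
  remaining nodes by continuing along its base tour, and leaving a base tour unsplit is an admissible
  splitting; hence no vehicle of Regretless returns after time \<open>X\<close>. Conversely, in any family of truck
  and drone tours with makespan \<open>M\<close>, each truck can append at most \<open>\<lceil>kd / kt\<rceil>\<close> of the drone tours to
  its own one. As a drone tour has length at most \<open>\<alpha> M\<close>, this gives \<open>X \<le> (1 + \<lceil>kd / kt\<rceil> \<alpha>) M\<close>.\<close>

section \<open>Walks and joined node sequences\<close>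

locale positive_network = wf_digraph "with_proj (network K)" for K :: "'v rdp" +
  assumes edge_len_pos: "e \<in> parcs (network K) \<Longrightarrow> 0 < edge_len K e"
begin

lemma walk_len_nonneg: "walk K u p v \<Longrightarrow> 0 \<le> walk_len K p"
  by (induction p arbitrary: u) (auto simp: awalk_Cons_iff less_imp_le[OF edge_len_pos] intro!: add_nonneg_nonneg)

lemma walk_len_pos: "walk K u p v \<Longrightarrow> p \<noteq> [] \<Longrightarrow> 0 < walk_len K p"
  using walk_len_nonneg
  by (cases p) (auto simp: awalk_Cons_iff intro!: add_pos_nonneg edge_len_pos)

text \<open>Turns a joined node sequence into a single walk, so that plans can be compared with
  families of tours and covering walks. The length depends on the node sequence alone, whichever
  shortest paths are chosen.\<close>

lemma joins_walk:
  assumes "joins K (u # vs) p" "u \<in> pverts (network K)"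
  shows "walk K u p (last (u # vs)) \<and> set (u # vs) \<subseteq> set (walk_verts K u p) \<and>
    walk_len K p = seq_len K (u # vs)"
  using assms
proof (induction vs arbitrary: u p)
  case Nil
  then show ?case by (simp add: awalk_Nil_iff)
next
  case (Cons v vs)
  then obtain q r where qr: "p = q @ r" "walk K u q v" "walk_len K q = sp_dist K u v"
    "joins K (v # vs) r"
    by auto
  then have IH: "walk K v r (last (v # vs))" "set (v # vs) \<subseteq> set (walk_verts K v r)"
    "walk_len K r = seq_len K (v # vs)"
    using Cons.IH[OF qr(4)] awalk_last_in_verts[OF qr(2)] by auto
  have "set (walk_verts K u p) = set (walk_verts K u q) \<union> set (walk_verts K v r)"
    unfolding qr(1) by (rule set_awalk_verts_append[OF qr(2) IH(1)])
  moreover have "u \<in> set (walk_verts K u q)" using hd_in_awalk_verts(1)[OF qr(2)] .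
  moreover have "walk K u p (last (v # vs))" unfolding qr(1) by (rule awalk_appendI[OF qr(2) IH(1)])
  ultimately show ?case using IH qr(1,3) by auto
qed

text \<open>Used to cut a base tour at the last node of the truck's segment. The cut node
  \<open>w\<close> ends the first piece and starts the second.\<close>

lemma joins_append:
  assumes "joins K (us @ w # vs) p"
  shows "\<exists>q r. p = q @ r \<and> joins K (us @ [w]) q \<and> joins K (w # vs) r"
  using assms
proof (induction us arbitrary: p)
  case Nil
  then show ?case by simp
next
  case (Cons u us)
  obtain v ws where ws: "us @ w # vs = v # ws" by (cases us) auto
  with Cons.prems obtain q r where qr: "p = q @ r" "walk K u q v" "walk_len K q = sp_dist K u v"
    "joins K (us @ w # vs) r"
    by auto
  from Cons.IH[OF qr(4)] obtain q' r' where
    "r = q' @ r'" "joins K (us @ [w]) q'" "joins K (w # vs) r'"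
    by blast
  moreover obtain ws' where "us @ [w] = v # ws'" using ws by (cases us) auto
  ultimately show ?case using qr by (intro exI[of _ "q @ q'"] exI[of _ r']) auto
qed

text \<open>Each node of \<open>p\<close> is reached after a prefix of \<open>p\<close>, and the
  rest of \<open>p\<close> has nonnegative length. The continuation \<open>q\<close> is arbitrary,
  so the fact applies before anything is known about the replanned walk.\<close>

lemma reached_append:
  assumes "walk K (depot K) p u" "walk K u q v"
  shows "set (walk_verts K (depot K) p) \<subseteq> reached K 1 (p @ q) (walk_len K p)"
proof
  fix x assume "x \<in> set (walk_verts K (depot K) p)"
  then obtain j where j: "j \<le> length p" "x = walk_verts K (depot K) p ! j"
    by (auto simp: in_set_conv_nth length_awalk_verts less_Suc_eq_le)
  have "walk K (depot K) (take j p @ drop j p) u" using assms(1) by simp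
  then have "0 \<le> walk_len K (drop j p)" unfolding awalk_append_iff using walk_len_nonneg by blast
  moreover have "walk_len K p = walk_len K (take j p) + walk_len K (drop j p)"
    by (subst awalk_cost_append[symmetric]) simp
  moreover have "walk_verts K (depot K) (p @ q) ! j = x"
    using awalk_verts_append[OF awalk_appendI[OF assms]] j
    by (simp add: nth_append length_awalk_verts)
  ultimately show "x \<in> reached K 1 (p @ q) (walk_len K p)"
    unfolding reached_def using j by (intro CollectI exI[of _ j]) auto
qed

end

lemma rdp_instance_positive_network: "rdp_instance K D \<Longrightarrow> positive_network K"
proof
  assume K: "rdp_instance K D"
  then interpret G: pair_graph "network K" by (simp add: rdp_instance_def)
  show "tail (with_proj (network K)) e \<in> verts (with_proj (network K))"
    "head (with_proj (network K)) e \<in> verts (with_proj (network K))"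
    if "e \<in> arcs (with_proj (network K))" for e
    using that G.wellformed by auto
  show "0 < edge_len K e" if "e \<in> parcs (network K)" for e
    using K that by (cases e) (auto simp: rdp_instance_def)
qed

section \<open>Makespans\<close>

lemma makespan_le_iff:
  assumes "T \<noteq> []"
  shows "makespan K T U \<le> m \<longleftrightarrow>
    (\<forall>p \<in> set T. walk_len K p \<le> m) \<and> (\<forall>p \<in> set U. walk_len K p / speed K \<le> m)"
  unfolding makespan_def using assms by (subst Max_le_iff) auto

lemmas le_makespan = makespan_le_iff[THEN iffD1, OF _ order_refl]

section \<open>Replacing drone tours by additional truck tours\<close>

context positive_network
begin

lemma tour_append: "tour K p \<Longrightarrow> tour K q \<Longrightarrow> tour K (p @ q)"
  unfolding tour_def by (rule awalk_appendI)

lemma tour_nodes_append: "tour K p \<Longrightarrow> tour K q \<Longrightarrow> tour_nodes K (p @ q) = tour_nodes K p \<union> tour_nodes K q"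
  unfolding tour_def tour_nodes_def by (rule set_awalk_verts_append)

lemma tour_concat:
  assumes "tour K p" "\<forall>q \<in> set qs. tour K q"
  shows "tour K (p @ concat qs)"
    and "tour_nodes K (p @ concat qs) = tour_nodes K p \<union> (\<Union>q \<in> set qs. tour_nodes K q)"
proof -
  have "tour K (p @ concat qs) \<and>
    tour_nodes K (p @ concat qs) = tour_nodes K p \<union> (\<Union>q \<in> set qs. tour_nodes K q)"
    using assms
  proof (induction qs arbitrary: p)
    case (Cons q qs)
    then have "tour K (p @ q)" by (simp add: tour_append)
    from Cons.IH[OF this] Cons.prems show ?case by (auto simp: tour_nodes_append)
  qed simp
  then show "tour K (p @ concat qs)"
    "tour_nodes K (p @ concat qs) = tour_nodes K p \<union> (\<Union>q \<in> set qs. tour_nodes K q)"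
    by auto
qed

lemma walk_len_concat_le:
  assumes "\<forall>q \<in> set qs. walk_len K q \<le> m"
  shows "walk_len K (concat qs) \<le> real (length qs) * m"
  using assms
proof (induction qs)
  case (Cons q qs)
  then have "walk_len K q \<le> m" "walk_len K (concat qs) \<le> real (length qs) * m" by auto
  then show ?case by (simp add: algebra_simps)
qed simp

text \<open>All tours are closed at the depot, so a truck can perform several in succession at the
  sum of their lengths. The drone tours are cut into \<open>k\<close> blocks of at most
  \<open>c\<close>, one block per truck.\<close>

lemma trucks_only_makespan_le:
  assumes opt: "optimal_family K k 0 W S []" and fam: "family K k n W T U"
    and k: "k \<ge> 1" and speed: "speed K > 0" and n: "n \<le> k * c"
  shows "makespan K S [] \<le> (1 + real c * speed K) * makespan K T U"
proof -
  let ?M = "makespan K T U"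
  have len: "length T = k" "length U = n" and tours: "\<forall>p \<in> set T \<union> set U. tour K p"
    and cover: "W \<subseteq> (\<Union>p \<in> set T \<union> set U. tour_nodes K p)"
    using fam by (auto simp: family_def)
  have ne: "T \<noteq> []" using len k by auto
  note M = le_makespan[OF ne, of K U]
  \<comment> \<open>Blocks can be shorter than \<open>c\<close>; this sign allows their length to be
    replaced by \<open>c\<close> in the final estimate.\<close>
  have M0: "0 \<le> ?M"
  proof -
    from ne obtain p where p: "p \<in> set T" by (cases T) auto
    then have "0 \<le> walk_len K p" using tours walk_len_nonneg by (auto simp: tour_def)
    also have "\<dots> \<le> ?M" using M p by blast
    finally show ?thesis .
  qed
  \<comment> \<open>Block \<open>i\<close> holds the positions from \<open>c * i\<close> to
    \<open>c * i + c - 1\<close> of \<open>U\<close>, truncated at the end of \<open>U\<close> and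
    possibly empty.\<close>
  define block where "block i = take c (drop (c * i) U)" for i
  have block_set: "set (block i) \<subseteq> set U" for i
    unfolding block_def by (meson order_trans set_drop_subset set_take_subset)
  define T' where "T' = map (\<lambda>i. T ! i @ concat (block i)) [0..<k]"
  have T_in: "T ! i \<in> set T" if "i < k" for i using that len by simp
  have conc: "tour K (T ! i @ concat (block i))"
    "tour_nodes K (T ! i @ concat (block i)) =
       tour_nodes K (T ! i) \<union> (\<Union>q \<in> set (block i). tour_nodes K q)" if "i < k" for i
    using tour_concat[of "T ! i" "block i"] T_in[OF that] block_set[of i] tours by auto
  have "family K k 0 W T' []"
    unfolding family_def
  proof (intro conjI)
    show "\<forall>p \<in> set T' \<union> set []. tour K p" using conc by (auto simp: T'_def)
    have "tour_nodes K p \<subseteq> (\<Union>p \<in> set T'. tour_nodes K p)" if "p \<in> set T \<union> set U" for p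
    proof -
      obtain i where "i < k" "p = T ! i \<or> p \<in> set (block i)"
      proof (cases "p \<in> set T")
        case True
        then show ?thesis using that len by (auto simp: in_set_conv_nth)
      next
        case False
        then obtain j where j: "j < n" "p = U ! j"
          using \<open>p \<in> set T \<union> set U\<close> len by (auto simp: in_set_conv_nth)
        \<comment> \<open>Drone tour \<open>j\<close> goes to truck \<open>j div c\<close>, at
          position \<open>j mod c\<close> of its block; the bound on \<open>j\<close> also forces
          \<open>c > 0\<close>.\<close>
        with n have "j < k * c" by simp
        then have "c > 0" "j div c < k"
          by (auto simp: less_mult_imp_div_less intro!: Nat.gr0I)
        moreover have "block (j div c) ! (j mod c) = p" "j mod c < length (block (j div c))"
          using j len \<open>c > 0\<close> minus_mod_eq_mult_div[of j c]
          by (auto simp: block_def less_diff_conv)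
        ultimately show ?thesis using that by (metis nth_mem)
      qed
      then show ?thesis using conc(2) by (auto simp: T'_def)
    qed
    then show "W \<subseteq> (\<Union>p \<in> set T' \<union> set []. tour_nodes K p)" using cover by fastforce
  qed (simp_all add: T'_def)
  then have "makespan K S [] \<le> makespan K T' []" using opt by (simp add: optimal_family_def)
  also have "\<dots> \<le> (1 + real c * speed K) * ?M"
  proof (subst makespan_le_iff)
    show "T' \<noteq> []" using k by (simp add: T'_def)
    have "walk_len K (T ! i @ concat (block i)) \<le> (1 + real c * speed K) * ?M" if "i < k" for i
    proof -
      have "walk_len K (T ! i) \<le> ?M" using M T_in[OF that] by blast
      moreover have "\<forall>q \<in> set (block i). walk_len K q \<le> ?M * speed K"
        using M block_set[of i] speed by (auto simp: pos_divide_le_eq)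
      then have "walk_len K (concat (block i)) \<le> real (length (block i)) * (?M * speed K)"
        by (rule walk_len_concat_le)
      moreover have "real (length (block i)) * (?M * speed K) \<le> real c * (?M * speed K)"
        using M0 speed by (intro mult_right_mono) (auto simp: block_def)
      ultimately show ?thesis by (simp add: algebra_simps)
    qed
    then show "(\<forall>p \<in> set T'. walk_len K p \<le> (1 + real c * speed K) * ?M) \<and>
      (\<forall>p \<in> set []. walk_len K p / speed K \<le> (1 + real c * speed K) * ?M)"
      by (auto simp: T'_def)
  qed
  finally show ?thesis .
qed

text \<open>Visiting a node other than the depot takes at least one arc, of positive length. This
  later keeps the denominator of the ratio away from 0.\<close>

lemma makespan_pos:
  assumes fam: "family K m 0 W T []" and v: "v \<in> W" "v \<noteq> depot K"
  shows "0 < makespan K T []"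
proof -
  obtain p where p: "p \<in> set T" "tour K p" "v \<in> tour_nodes K p"
    using assms by (force simp: family_def)
  with v(2) have "p \<noteq> []" by (auto simp: tour_nodes_def)
  with p have "0 < walk_len K p" using walk_len_pos by (auto simp: tour_def)
  also have "\<dots> \<le> makespan K T []" using le_makespan[of T K "[]"] p(1) by fastforce
  finally show ?thesis .
qed

end

section \<open>Regretless returns no later than the trucks on their base tours\<close>

lemma splitting_cost_segment_le:
  assumes "e \<in> set (tl ds)"
  shows "seq_len K (closed_seq K (rev e)) / speed K \<le> splitting_cost K ds"
  using assms by (cases ds) (auto intro!: Max_ge)

lemma list_all2_in_set_right: "list_all2 R xs ys \<Longrightarrow> y \<in> set ys \<Longrightarrow> \<exists>x \<in> set xs. R x y"
  by (induction rule: list_all2_induct) auto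

text \<open>Includes the empty splitting, which is the one belonging to a base tour without
  customers.\<close>

lemma concat_segments: "concat ds = truck_segment ds @ concat (tl ds)"
  by (cases ds) (auto simp: truck_segment_def)

text \<open>The witness \<open>T\<close> consists of the walks behind \<open>base_tours_ok\<close>;
  the plan itself records only their node sequences.\<close>

lemma completion_time_le_base_makespan:
  assumes P: "regretless_policy P" and K: "rdp_instance K D"
  shows "\<exists>T. optimal_family K (trucks K) 0 (customers K) T [] \<and>
    completion_time P K D \<le> makespan K T []"
proof -
  interpret positive_network K using K by (rule rdp_instance_positive_network)
  have depot: "depot K \<in> pverts (network K)" and trucks: "trucks K \<ge> 1"
    using K by (auto simp: rdp_instance_def)
  define \<pi> where "\<pi> = stage1 P K"
  note policy = P[unfolded regretless_policy_def]
  have stage1: "first_stage_ok K \<pi>"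
    using conjunct1[OF policy] K unfolding \<pi>_def by blast
  have stage2: "optimal_covering_walk K (replan_node P K i)
      (damaged_left P K D i \<union> unvisited_left P K D i) (stage2 P K D i)" if "i < trucks K" for i
    using conjunct1[OF conjunct2[OF policy]] K that by blast
  from stage1 obtain T where joinT: "list_all2 (\<lambda>s p. joins K (closed_seq K s) p) (base_tours \<pi>) T"
    and opt: "optimal_family K (trucks K) 0 (customers K) T []"
    by (auto simp: first_stage_ok_def base_tours_ok_def)
  have lenT: "length T = trucks K" using opt by (simp add: optimal_family_def family_def)
  have T_ne: "T \<noteq> []" using lenT trucks by auto
  have T_le: "walk_len K (T ! i) \<le> makespan K T []" if "i < trucks K" for i
    using le_makespan[OF T_ne, of K "[]"] lenT that by auto
  have base: "joins K (closed_seq K (base_tours \<pi> ! i)) (T ! i)" if "i < trucks K" for i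
    using joinT lenT that by (auto simp: list_all2_conv_all_nth)
  have seg: "optimal_splitting K (base_tours \<pi> ! i) (1 + crew \<pi> ! i) (segments \<pi> ! i)"
    "joins K (depot K # truck_segment (segments \<pi> ! i)) (truck_out \<pi> ! i)"
    "list_all2 (\<lambda>d p. joins K (closed_seq K (rev d)) p) (tl (segments \<pi> ! i)) (drone_tours \<pi> ! i)"
    if "i < trucks K" for i
    using stage1 that by (auto simp: first_stage_ok_def)
  have truck: "walk_len K (truck_route P K D i) \<le> makespan K T []" if i: "i < trucks K" for i
  proof -
    define d where "d = truck_segment (segments \<pi> ! i)"
    define ys where "ys = concat (tl (segments \<pi> ! i))"
    define u where "u = last (depot K # d)"
    define out where "out = truck_out \<pi> ! i"
    define W where "W = damaged_left P K D i \<union> unvisited_left P K D i"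
    have s: "base_tours \<pi> ! i = d @ ys"
      using seg(1)[OF i] concat_segments[of "segments \<pi> ! i"]
      by (simp add: optimal_splitting_def splitting_def d_def ys_def)
    \<comment> \<open>If the truck has no segment, \<open>u\<close> is the depot and the
      \<open>butlast\<close> is empty, so no case distinction arises.\<close>
    have du: "depot K # d = butlast (depot K # d) @ [u]" by (simp add: u_def)
    have "closed_seq K (base_tours \<pi> ! i) = (butlast (depot K # d) @ [u]) @ ys @ [depot K]"
      unfolding du[symmetric] by (simp add: closed_seq_def s)
    then have "joins K (butlast (depot K # d) @ u # ys @ [depot K]) (T ! i)"
      using base[OF i] by simp
    from joins_append[OF this, folded du] obtain q r where
      qr: "T ! i = q @ r" "joins K (depot K # d) q" "joins K (u # ys @ [depot K]) r"
      by blast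
    note out = joins_walk[OF seg(2)[OF i] depot, folded d_def u_def out_def]
    note q = joins_walk[OF qr(2) depot, folded u_def]
    have u: "u \<in> pverts (network K)" using q awalk_last_in_verts by fastforce
    note r = joins_walk[OF qr(3) u]
    have node: "replan_node P K i = u" by (simp add: replan_node_def u_def d_def \<pi>_def)
    note cw = stage2[OF i, unfolded node optimal_covering_walk_def, folded W_def]
    have "set (walk_verts K (depot K) out) \<subseteq>
      reached K 1 (truck_route P K D i) (replan_time P K i)"
      using reached_append[of out u "stage2 P K D i" "depot K"] out cw
      by (simp add: truck_route_def replan_time_def out_def \<pi>_def)
    then have "set d \<subseteq> reached K 1 (truck_route P K D i) (replan_time P K i)"
      using out by auto
    \<comment> \<open>What remains lies on the base tour, and the truck itself has already reached
      all of \<open>d\<close>.\<close>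
    then have "W \<subseteq> set ys"
      using i s by (auto simp: W_def damaged_left_def unvisited_left_def visited_def \<pi>_def)
    with r have "walk K u r (depot K)" "W \<subseteq> set (walk_verts K u r)" by auto
    \<comment> \<open>The rest \<open>r\<close> of the base tour is an admissible competitor for the
      replanned walk.\<close>
    then have "walk_len K (stage2 P K D i) \<le> walk_len K r" using cw by blast
    \<comment> \<open>\<open>out\<close> and \<open>q\<close> may be different walks, but they join
      the same nodes by shortest paths and so have equal length.\<close>
    then have "walk_len K (truck_route P K D i) \<le> walk_len K (T ! i)"
      using out q qr(1) by (simp add: truck_route_def out_def \<pi>_def)
    with T_le[OF i] show ?thesis by simp
  qed
  have drone: "walk_len K p / speed K \<le> makespan K T []"
    if i: "i < trucks K" and p: "p \<in> set (drone_tours \<pi> ! i)" for i p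
  proof -
    define ds where "ds = segments \<pi> ! i"
    define s where "s = base_tours \<pi> ! i"
    obtain e where e: "e \<in> set (tl ds)" "joins K (closed_seq K (rev e)) p"
      using list_all2_in_set_right[OF seg(3)[OF i, folded ds_def] p] by blast
    have split: "splitting s (1 + crew \<pi> ! i) ds"
      "\<And>ds'. splitting s (1 + crew \<pi> ! i) ds' \<Longrightarrow> splitting_cost K ds \<le> splitting_cost K ds'"
      using seg(1)[OF i] by (auto simp: optimal_splitting_def s_def ds_def)
    have "e \<in> set ds" using e(1) by (cases ds) auto
    \<comment> \<open>Segments must be nonempty, so \<open>[s]\<close> is a splitting only for
      nonempty \<open>s\<close>; the drone's segment \<open>e\<close> ensures this.\<close>
    with split(1) have "s \<noteq> []" by (auto simp: splitting_def)
    then have "splitting s (1 + crew \<pi> ! i) [s]" by (simp add: splitting_def)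
    have "walk_len K p / speed K = seq_len K (closed_seq K (rev e)) / speed K"
      using joins_walk[of "depot K" "rev e @ [depot K]" p] e(2) depot by (simp add: closed_seq_def)
    also have "\<dots> \<le> splitting_cost K ds" by (rule splitting_cost_segment_le[OF e(1)])
    also have "\<dots> \<le> splitting_cost K [s]" by (rule split(2)) fact
    \<comment> \<open>In the splitting \<open>[s]\<close> no drone has a segment, so its cost is the
      truck's closed tour through all of \<open>s\<close>.\<close>
    also have "\<dots> = walk_len K (T ! i)"
      using joins_walk[of "depot K" "s @ [depot K]" "T ! i"] base[OF i] depot
      by (simp add: closed_seq_def s_def)
    also have "\<dots> \<le> makespan K T []" by (rule T_le[OF i])
    finally show ?thesis .
  qed
  have "length (drone_tours \<pi>) = trucks K" using stage1 by (simp add: first_stage_ok_def)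
  then have "\<exists>i < trucks K. p \<in> set (drone_tours \<pi> ! i)"
    if "p \<in> set (concat (drone_tours \<pi>))" for p
    using that by (auto simp: in_set_conv_nth[of _ "drone_tours \<pi>"])
  then have "completion_time P K D \<le> makespan K T []"
    unfolding completion_time_def using truck drone trucks
    by (subst makespan_le_iff) (auto simp: \<pi>_def[symmetric] simp del: set_concat)
  with opt show ?thesis by blast
qed

section \<open>Lower bound for the full-information optimum and the competitive ratio\<close>

lemma full_info_opt_lower_bound:
  assumes opt: "optimal_family K (trucks K) 0 (customers K) S []" and K: "rdp_instance K D"
    and c: "drones K \<le> trucks K * c"
  shows "makespan K S [] / (1 + real c * speed K) \<le> full_info_opt K D"
  unfolding full_info_opt_def
proof (rule cInf_greatest)
  interpret positive_network K using K by (rule rdp_instance_positive_network)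
  have inst: "depot K \<in> pverts (network K)" "trucks K \<ge> 1" "speed K > 0" "D \<subseteq> customers K"
    using K by (auto simp: rdp_instance_def)
  let ?X = "{makespan K T U | T U. family K (trucks K) (drones K) (customers K) T U \<and>
    D \<subseteq> (\<Union>p \<in> set T. tour_nodes K p)}"
  \<comment> \<open>\<open>S\<close> with all drones idle at the depot is admissible: its trucks
    visit every customer, hence all of \<open>D\<close>. So the infimum is over a nonempty
    set.\<close>
  have S: "family K (trucks K) 0 (customers K) S []" using opt by (simp add: optimal_family_def)
  moreover have "tour K []" using inst(1) by (simp add: tour_def awalk_Nil_iff)
  ultimately have "family K (trucks K) (drones K) (customers K) S (replicate (drones K) [])"
    by (auto simp: family_def)
  moreover have "D \<subseteq> (\<Union>p \<in> set S. tour_nodes K p)" using S inst(4) by (auto simp: family_def)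
  ultimately have "makespan K S (replicate (drones K) []) \<in> ?X"
    by (intro CollectI exI conjI) (rule refl)
  then show "?X \<noteq> {}" by (metis empty_iff)
  fix m assume "m \<in> ?X"
  then obtain T U where m: "m = makespan K T U"
    and fam: "family K (trucks K) (drones K) (customers K) T U"
    by blast
  have "makespan K S [] \<le> (1 + real c * speed K) * m"
    unfolding m using trucks_only_makespan_le[OF opt fam inst(2,3) c] .
  moreover have "0 < 1 + real c * speed K" using inst(3) by (intro add_pos_nonneg) auto
  ultimately show "makespan K S [] / (1 + real c * speed K) \<le> m"
    by (simp add: pos_divide_le_eq mult.commute)
qed

theorem lemma16:
  fixes P :: "'v policy" and kt kd :: nat and \<alpha> :: real
  assumes "\<alpha> > 0" and "kt \<ge> 1" and "kd \<ge> 1"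
    and "regretless_policy P"
  shows "competitive_ratio P kt kd \<alpha> \<le> ereal (1 + real_of_int \<lceil>real kd / real kt\<rceil> * \<alpha>)"
  unfolding competitive_ratio_def
proof (rule SUP_least)
  fix I :: "'v rdp \<times> 'v set" assume "I \<in> {(K, D). rdp_instance K D \<and> trucks K = kt \<and> drones K = kd \<and> speed K = \<alpha>}"
  then obtain K D where I: "I = (K, D)" and K: "rdp_instance K D"
    and kt: "kt = trucks K" and kd: "kd = drones K" and \<alpha>: "\<alpha> = speed K"
    by auto
  interpret positive_network K using K by (rule rdp_instance_positive_network)
  \<comment> \<open>A natural number is needed as block length; the ceiling is nonnegative, so
    \<open>nat\<close> loses nothing.\<close>
  define c where "c = nat \<lceil>real kd / real kt\<rceil>"
  have c: "real c = real_of_int \<lceil>real kd / real kt\<rceil>" by (simp add: c_def)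
  have "real kd / real kt \<le> real c" unfolding c by (rule le_of_int_ceiling)
  then have "real kd \<le> real (kt * c)" using assms(2) by (simp add: pos_divide_le_eq mult.commute)
  then have kd_le: "drones K \<le> trucks K * c" unfolding kt kd of_nat_le_iff .
  obtain T where opt: "optimal_family K (trucks K) 0 (customers K) T []"
    and le: "completion_time P K D \<le> makespan K T []"
    using completion_time_le_base_makespan[OF assms(4) K] by blast
  obtain v where "v \<in> customers K" "v \<noteq> depot K"
    using K by (auto simp: rdp_instance_def customers_def)
  then have "0 < makespan K T []"
    using opt makespan_pos by (auto simp: optimal_family_def)
  moreover have r: "0 < 1 + real c * \<alpha>" using assms(1) by (intro add_pos_nonneg) auto
  moreover have lb: "makespan K T [] / (1 + real c * \<alpha>) \<le> full_info_opt K D"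
    unfolding \<alpha> by (rule full_info_opt_lower_bound[OF opt K kd_le])
  \<comment> \<open>A positive optimum turns the quotient of extended reals into an ordinary real
    quotient.\<close>
  ultimately have "0 < full_info_opt K D" by (meson divide_pos_pos less_le_trans)
  moreover have "completion_time P K D \<le> (1 + real c * \<alpha>) * full_info_opt K D"
    using le lb r by (simp add: pos_divide_le_eq mult.commute)
  ultimately show "(case I of (K, D) \<Rightarrow> ereal (completion_time P K D) / ereal (full_info_opt K D)) \<le>
      ereal (1 + real_of_int \<lceil>real kd / real kt\<rceil> * \<alpha>)"
    by (simp add: I pos_divide_le_eq c)
qed

end
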